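(* Let $n,m$ be nonnegative integers, let $\alpha,\beta$ be positive real numbers, and let $0\leq a\leq 1$. Then $$\sum_{k=0}^m\binom{n+k}{k}B_a(\alpha+k,\beta+n+1)+\sum_{k=0}^n\binom{m+k}{k}B_a(\alpha+m+1,\beta+k)=B_a(\alpha,\beta).$$
   Context: For real $x,y>0$ and $0\le a\le 1$, $B_a(x,y)=\int_0^a t^{x-1}(1-t)^{y-1}\,dt$ denotes the incomplete beta function. *)

theory Defs
  imports "HOL-Analysis.Analysis"
begin

definition incomplete_Beta :: "real \<Rightarrow> real \<Rightarrow> real \<Rightarrow> real" where
  "incomplete_Beta a x y = integral {0..a} (\<lambda>t. t powr (x - 1) * (1 - t) powr (y - 1))"

(* The integral above is a genuine one (not the default value 0 of a non-integrable function). *)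
lemma incomplete_Beta_integrable:
  assumes "x > 0" "y > 0" "0 \<le> a" "a \<le> 1"
  shows "(\<lambda>t. t powr (x - 1) * (1 - t) powr (y - 1)) integrable_on {0..a::real}"
proof (rule integrable_subinterval_real)
  show "(\<lambda>t. t powr (x - 1) * (1 - t) powr (y - 1)) integrable_on {0..1::real}"
    using has_integral_Beta_real[OF assms(1,2)] by blast
  show "{0..a} \<subseteq> {0..1}" using assms by auto
qed

lemma incomplete_Beta_1:
  assumes "x > 0" "y > 0"
  shows "incomplete_Beta 1 x y = Beta x y"
  unfolding incomplete_Beta_def
  using has_integral_Beta_real[OF assms] by (rule integral_unique)

end

theory Submission
  imports Defs
begin

text \<open>
  The theorem is a polynomial identity integrated against the beta weight.  For \<open>x + y = 1\<close>,
  \<open>y^(n+1) * (\<Sum>k\<le>m. (n+k choose k) * x^k) + x^(m+1) * (\<Sum>k\<le>n. (m+k choose k) * y^k) = 1\<close>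
  (\<open>two_sided_negative_binomial\<close>).  Probabilistically: in independent trials with success
  probability \<open>x\<close> and failure probability \<open>y\<close>, either \<open>n + 1\<close> failures or \<open>m + 1\<close> successes
  come first, and the race ends within \<open>n + m + 1\<close> trials.  The summand \<open>(n+k choose k) * x^k * y^(n+1)\<close> is the probability that the
  failures win after exactly \<open>k\<close> successes, and the other sum covers the remaining case.

  Putting \<open>x = t\<close> and \<open>y = 1 - t\<close>, multiplying by \<open>t powr (\<alpha> - 1) * (1 - t) powr (\<beta> - 1)\<close>
  and integrating over \<open>[0, a]\<close>, each power of \<open>t\<close> or of \<open>1 - t\<close> is absorbed by a shift of a
  parameter of the incomplete beta function.
\<close>

text \<open>
  By Pascal's rule, multiplication by \<open>1 - y\<close> lowers the upper index of the binomial
  coefficients by one: the truncated form of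
  \<open>(1 - y) * (1 - y)^(-(m+2)) = (1 - y)^(-(m+1))\<close>, the last term being the truncation error.
\<close>

lemma one_minus_times_truncated_negative_binomial:
  fixes y :: "'a::comm_ring_1"
  shows "(1 - y) * (\<Sum>k=0..n. of_nat ((Suc m + k) choose k) * y ^ k)
       = (\<Sum>k=0..n. of_nat ((m + k) choose k) * y ^ k)
         - of_nat ((Suc m + n) choose n) * y ^ Suc n"
proof (induction n)
  case 0
  then show ?case by simp
next
  case (Suc n)
  have "of_nat ((Suc m + Suc n) choose Suc n)
      = of_nat ((Suc m + n) choose n) + (of_nat ((m + Suc n) choose Suc n) :: 'a)"
    by simp
  then show ?case
    unfolding sum.atLeast0_atMost_Suc distrib_left Suc.IH
    by (simp add: algebra_simps del: binomial_Suc_Suc)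
qed

lemma two_sided_negative_binomial:
  fixes x y :: "'a::comm_ring_1"
  assumes "x + y = 1"
  shows "y ^ Suc n * (\<Sum>k=0..m. of_nat ((n + k) choose k) * x ^ k)
       + x ^ Suc m * (\<Sum>k=0..n. of_nat ((m + k) choose k) * y ^ k) = 1"
proof -
  have x: "x = 1 - y" using assms by (simp add: eq_diff_eq)
  show ?thesis
  proof (induction m)
    case 0
    have "x * (\<Sum>k=0..n. y ^ k) = 1 - y ^ Suc n"
      unfolding x atLeast0AtMost by (rule sum_gp_basic)
    then show ?case by simp
  next
    case (Suc m)
    define S where "S = (\<Sum>k=0..n. of_nat ((m + k) choose k) * y ^ k)"
    define T where "T = (\<Sum>k=0..n. of_nat ((Suc m + k) choose k) * y ^ k)"
    define c :: 'a where "c = of_nat ((n + Suc m) choose Suc m)"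
    have "(Suc m + n) choose n = (n + Suc m) choose Suc m"
      using binomial_symmetric[of n "Suc m + n"] by (simp add: add.commute)
    then have "x * T = S - c * y ^ Suc n"
      unfolding x T_def S_def c_def
      by (simp only: one_minus_times_truncated_negative_binomial)
    then have lower: "x ^ Suc (Suc m) * T = x ^ Suc m * (S - c * y ^ Suc n)"
      by (simp only: power_Suc2[of x "Suc m"] mult.assoc)
    define R where "R = (\<Sum>k=0..m. of_nat ((n + k) choose k) * x ^ k)"
    have "y ^ Suc n * (R + c * x ^ Suc m) + x ^ Suc (Suc m) * T = y ^ Suc n * R + x ^ Suc m * S"
      unfolding lower by (simp add: algebra_simps del: power_Suc)
    also have "\<dots> = 1"
      unfolding R_def S_def by (rule Suc.IH)
    finally show ?case
      unfolding R_def T_def c_def sum.atLeast0_atMost_Suc .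
  qed
qed

text \<open>
  At \<open>t = 0\<close> this relies on \<open>0 powr b = 0\<close> for every exponent, including \<open>b = 0\<close>; it makes the
  comparison of the integrands valid at both endpoints.
\<close>

lemma powr_add_nat:
  fixes t b :: real
  assumes "0 \<le> t"
  shows "t powr (b + real k) = t powr b * t ^ k"
  using assms by (cases "t = 0") (simp_all add: powr_add powr_realpow)

lemma incomplete_Beta_has_integral:
  assumes "x > 0" "y > 0" "0 \<le> a" "a \<le> 1"
  shows "((\<lambda>t. t powr (x - 1) * (1 - t) powr (y - 1)) has_integral incomplete_Beta a x y) {0..a}"
  unfolding incomplete_Beta_def
  using incomplete_Beta_integrable[OF assms] by (rule integrable_integral)

theorem mainTheorem3:
  fixes n m :: nat and \<alpha> \<beta> a :: real
  assumes "\<alpha> > 0" and "\<beta> > 0" and "0 \<le> a" and "a \<le> 1"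
  shows "(\<Sum>k=0..m. real ((n + k) choose k) * incomplete_Beta a (\<alpha> + real k) (\<beta> + real n + 1))
       + (\<Sum>k=0..n. real ((m + k) choose k) * incomplete_Beta a (\<alpha> + real m + 1) (\<beta> + real k))
       = incomplete_Beta a \<alpha> \<beta>" (is "?L = _")
proof -
  define w where "w x y t = t powr (x - 1) * (1 - t) powr (y - 1)" for x y t :: real
  have w_integral: "(w x y has_integral incomplete_Beta a x y) {0..a}" if "x > 0" "y > 0" for x y
    unfolding w_def using incomplete_Beta_has_integral that assms by blast
  have w_shift: "w (\<alpha> + real i) (\<beta> + real j) t = w \<alpha> \<beta> t * (t ^ i * (1 - t) ^ j)"
    if "t \<in> {0..a}" for i j t
  proof -
    have "0 \<le> t" "0 \<le> 1 - t" using that assms by auto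
    then show ?thesis
      using powr_add_nat[of t "\<alpha> - 1" i] powr_add_nat[of "1 - t" "\<beta> - 1" j]
      by (simp add: w_def algebra_simps)
  qed
  let ?f = "\<lambda>t. (\<Sum>k=0..m. real ((n + k) choose k) * w (\<alpha> + real k) (\<beta> + real (Suc n)) t)
              + (\<Sum>k=0..n. real ((m + k) choose k) * w (\<alpha> + real (Suc m)) (\<beta> + real k) t)"
  have "(?f has_integral
          (\<Sum>k=0..m. real ((n + k) choose k) * incomplete_Beta a (\<alpha> + real k) (\<beta> + real (Suc n)))
        + (\<Sum>k=0..n. real ((m + k) choose k) * incomplete_Beta a (\<alpha> + real (Suc m)) (\<beta> + real k)))
        {0..a}"
    using assms
    by (intro has_integral_add has_integral_sum has_integral_mult_right w_integral) auto
  then have L: "(?f has_integral ?L) {0..a}"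
    by (simp add: algebra_simps)
  have "?f t = w \<alpha> \<beta> t" if "t \<in> {0..a}" for t
  proof -
    have "?f t = w \<alpha> \<beta> t
        * ((1 - t) ^ Suc n * (\<Sum>k=0..m. real ((n + k) choose k) * t ^ k)
           + t ^ Suc m * (\<Sum>k=0..n. real ((m + k) choose k) * (1 - t) ^ k))"
      unfolding w_shift[OF that] distrib_left sum_distrib_left
      by (intro arg_cong2[where f = "(+)"] sum.cong refl) (simp_all only: mult_ac)
    also have "\<dots> = w \<alpha> \<beta> t"
      using two_sided_negative_binomial[of t "1 - t" n m] by simp
    finally show ?thesis .
  qed
  then have "(w \<alpha> \<beta> has_integral ?L) {0..a}"
    using L by (rule has_integral_eq)
  then show ?thesis
    using w_integral[OF assms(1,2)] by (rule has_integral_unique)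
qed

end
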